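(* Let $1\leq s\leq n$ be integers, let $\pi,\nu$ be probability distributions on $\mathbb{R}^n$, let $h$ be a probability density on $\mathbb{R}$, and let $\mathcal{A}:\mathbb{R}^n\to[0,1]$ be (measurable) and arbitrary. Let $Z\sim\pi$ and $\zeta\sim\nu$ be independent. Then the smoothed algorithm $\mathcal{A}_{\mathrm{smth}}$ satisfies \[\frac{1}{\binom ns}\sum_{S\in\binom{[n]}{s}}\mathbb{E}_{Z\sim\pi,\zeta\sim\nu}\Big[\big(\mathcal{A}_{\mathrm{smth}}(Z)-\mathcal{A}_{\mathrm{smth}}(Z\circ\mathbf{1}_{S^c}+\zeta\circ\mathbf{1}_S)\big)^2\Big]\leq\frac{s}{4n}\,\mathbb{E}\Big[\max_{S\in\binom{[n]}{s}}\Delta_h(\zeta_S-Z_S)\Big].\]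
   Context: $[n]=\{1,\dots,n\}$ and $\binom{[n]}{s}$ is the collection of all subsets of $[n]$ of cardinality $s$. $\mathbf{1}_S\in\{0,1\}^n$ is the indicator vector of $S\subseteq[n]$, $S^c=[n]\setminus S$, and $\circ$ is the elementwise product, so $Z\circ\mathbf{1}_{S^c}+\zeta\circ\mathbf{1}_S$ is $Z$ with the entries $i\in S$ replaced by $\zeta_i$. For $x\in\mathbb{R}^n$, $x_S=(x_i)_{i\in S}\in\mathbb{R}^s$. The smoothed algorithm is $\mathcal{A}_{\mathrm{smth}}(z)=\mathbb{E}[\mathcal{A}(z+\xi)]$, where $\xi=(\xi_1,\dots,\xi_n)$ has i.i.d. entries with density $h$. For $x\in\mathbb{R}^s$, $\Delta_h(x)=\mathrm{d}_{\chi^2}(x+W\,\|\,W)$ is the $\chi^2$-divergence of the law of $x+W$ from the law of $W$, where $W=(W_1,\dots,W_s)$ has i.i.d. entries with density $h$. Here $\mathrm{d}_{\chi^2}(\mu_1\|\mu_2)=\int(\frac{d\mu_1}{d\mu_2}-1)^2\,d\mu_2$ if $\mu_1\ll\mu_2$, and $+\infty$ otherwise; in particular the right-hand side of the bound may be $+\infty$. *)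

theory Defs
  imports "HOL-Probability.Probability"
begin

text \<open>
  A real vector with coordinates indexed by a finite set \<open>I\<close> is an extensional function on \<open>I\<close>;
  the Borel space of these vectors is \<open>\<Pi>\<^sub>M i\<in>I. borel\<close>. In particular \<open>I = {1..n}\<close> gives the
  \<open>n\<close>-dimensional space, and a subvector \<open>x\<^sub>S\<close> is indexed by \<open>S\<close> itself.
\<close>

abbreviation vec_borel :: "nat set \<Rightarrow> (nat \<Rightarrow> real) measure" where
  "vec_borel I \<equiv> (\<Pi>\<^sub>M i\<in>I. borel)"

definition noise :: "(real \<Rightarrow> real) \<Rightarrow> nat set \<Rightarrow> (nat \<Rightarrow> real) measure" where
  "noise h I = (\<Pi>\<^sub>M i\<in>I. density lborel (\<lambda>t. ennreal (h t)))"

definition smoothed ::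
    "(real \<Rightarrow> real) \<Rightarrow> nat \<Rightarrow> ((nat \<Rightarrow> real) \<Rightarrow> real) \<Rightarrow> (nat \<Rightarrow> real) \<Rightarrow> real" where
  "smoothed h n A z = (\<integral>\<xi>. A (\<lambda>i\<in>{1..n}. z i + \<xi> i) \<partial>noise h {1..n})"

definition resample :: "nat \<Rightarrow> nat set \<Rightarrow> (nat \<Rightarrow> real) \<Rightarrow> (nat \<Rightarrow> real) \<Rightarrow> nat \<Rightarrow> real" where
  "resample n S z \<zeta> =
     (\<lambda>i\<in>{1..n}. z i * indicator ({1..n} - S) i + \<zeta> i * indicator S i)"

text \<open>
  Note the argument order: \<open>absolutely_continuous \<mu>2 \<mu>1\<close> and \<open>RN_deriv \<mu>2 \<mu>1\<close> stand for
  \<open>\<mu>1 \<lless> \<mu>2\<close> and \<open>d\<mu>1/d\<mu>2\<close>. For finite measures the derivative is finite \<open>\<mu>2\<close>-almost everywhere,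
  so \<open>enn2real\<close> loses nothing.
\<close>

definition chi2_div :: "'a measure \<Rightarrow> 'a measure \<Rightarrow> ennreal" where
  "chi2_div \<mu>1 \<mu>2 =
     (if absolutely_continuous \<mu>2 \<mu>1
      then \<integral>\<^sup>+ x. ennreal ((enn2real (RN_deriv \<mu>2 \<mu>1 x) - 1)\<^sup>2) \<partial>\<mu>2
      else \<infinity>)"

definition shift_chi2 :: "(real \<Rightarrow> real) \<Rightarrow> nat set \<Rightarrow> (nat \<Rightarrow> real) \<Rightarrow> ennreal" where
  "shift_chi2 h I x =
     chi2_div (distr (noise h I) (vec_borel I) (\<lambda>w. \<lambda>i\<in>I. x i + w i)) (noise h I)"

end

theory Submission imports Defs begin

text \<open>
  Condition on \<open>Z\<close> and \<open>\<zeta>\<close>, and put \<open>f \<xi> = A (Z + \<xi>)\<close>. Resampling the coordinates in \<open>S\<close> shifts the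
  noise by \<open>\<zeta>\<^sub>S - Z\<^sub>S\<close> on \<open>S\<close> only. Hence, if \<open>F\<^sub>S\<close> is the mean of \<open>f\<close> given \<open>\<xi>\<^sub>S\<close>, the change of the
  smoothed algorithm is the difference of the integrals of \<open>F\<^sub>S\<close> against the shifted and the unshifted
  law of \<open>\<xi>\<^sub>S\<close>, and Cauchy-Schwarz (\<open>chi2_div_integral_bound\<close>) bounds its square by
  \<open>Var F\<^sub>S\<close> times the \<open>\<chi>\<^sup>2\<close>-divergence of the two laws.

  It remains to see that the average of \<open>Var F\<^sub>S\<close> over the \<open>s\<close>-subsets is at most
  \<open>s / n * Var f \<le> s / (4 * n)\<close>. This follows from nonnegative weights \<open>d i\<close> of total mass at most
  \<open>Var f\<close> with \<open>Var F\<^sub>S \<le> (\<Sum>i\<in>S. d i)\<close> for all \<open>S\<close> simultaneously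
  (\<open>additive_marginal_variance_bound\<close>), by counting how often an \<open>i\<close> lies in an \<open>s\<close>-subset. The
  weights are the variances of the increments of the martingale that reveals the coordinates one at a
  time. No conditional expectations are needed: \<open>additive_covariance_bound\<close> shows
  \<open>Cov f g ^ 2 \<le> (\<Sum>i\<in>S. d i) * Var g\<close> for every \<open>g\<close> that depends only on the coordinates in \<open>S\<close>, by
  induction on the index set. Integrating out one coordinate splits both covariance and variance into
  two summands, to which the induction hypothesis and Cauchy-Schwarz apply; the choice \<open>g = F\<^sub>S\<close> then
  gives the bound on \<open>Var F\<^sub>S\<close>.
\<close>

section \<open>Bounded measurable functions and covariances\<close>

text \<open>
  Real functions that are measurable and bounded on the whole space, so that all products and partial
  integrals that occur below exist everywhere.
\<close>

definition bounded_measurable :: "'a measure \<Rightarrow> ('a \<Rightarrow> real) \<Rightarrow> bool" where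
  "bounded_measurable P f \<longleftrightarrow> f \<in> borel_measurable P \<and> (\<exists>B. \<forall>x\<in>space P. \<bar>f x\<bar> \<le> B)"

lemma bounded_measurableI:
  "f \<in> borel_measurable P \<Longrightarrow> (\<And>x. x \<in> space P \<Longrightarrow> \<bar>f x\<bar> \<le> B) \<Longrightarrow> bounded_measurable P f"
  unfolding bounded_measurable_def by blast

lemma bounded_measurable_borel [measurable_dest]:
  "bounded_measurable P f \<Longrightarrow> f \<in> borel_measurable P"
  unfolding bounded_measurable_def by blast

lemma bounded_measurable_bound:
  assumes "bounded_measurable P f"
  obtains B where "0 \<le> B" "\<And>x. x \<in> space P \<Longrightarrow> \<bar>f x\<bar> \<le> B"
proof -
  from assms obtain B where B: "\<forall>x\<in>space P. \<bar>f x\<bar> \<le> B"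
    unfolding bounded_measurable_def by blast
  have "\<bar>f x\<bar> \<le> \<bar>B\<bar>" if "x \<in> space P" for x using B that by force
  then show ?thesis by (intro that[of "\<bar>B\<bar>"]) auto
qed

lemma bounded_measurable_mult:
  assumes f: "bounded_measurable P f" and g: "bounded_measurable P g"
  shows "bounded_measurable P (\<lambda>x. f x * g x)"
proof -
  obtain B where "0 \<le> B" "\<And>x. x \<in> space P \<Longrightarrow> \<bar>f x\<bar> \<le> B" using bounded_measurable_bound[OF f] by blast
  moreover obtain C where "0 \<le> C" "\<And>x. x \<in> space P \<Longrightarrow> \<bar>g x\<bar> \<le> C" using bounded_measurable_bound[OF g] by blast
  ultimately show ?thesis
    using f g by (intro bounded_measurableI[where B="B * C"])
      (auto simp: abs_mult intro!: mult_mono bounded_measurable_borel borel_measurable_times)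
qed

lemma bounded_measurable_add:
  assumes f: "bounded_measurable P f" and g: "bounded_measurable P g"
  shows "bounded_measurable P (\<lambda>x. f x + g x)"
proof -
  obtain B where "0 \<le> B" "\<And>x. x \<in> space P \<Longrightarrow> \<bar>f x\<bar> \<le> B" using bounded_measurable_bound[OF f] by blast
  moreover obtain C where "0 \<le> C" "\<And>x. x \<in> space P \<Longrightarrow> \<bar>g x\<bar> \<le> C" using bounded_measurable_bound[OF g] by blast
  ultimately show ?thesis
    using f g by (intro bounded_measurableI[where B="B + C"])
      (auto intro!: bounded_measurable_borel borel_measurable_add order.trans[OF abs_triangle_ineq] add_mono)
qed

lemma bounded_measurable_const: "bounded_measurable P (\<lambda>x. c)"
  by (rule bounded_measurableI[where B="\<bar>c\<bar>"]) auto

lemma bounded_measurable_compose: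
  "T \<in> measurable N P \<Longrightarrow> bounded_measurable P f \<Longrightarrow> bounded_measurable N (\<lambda>x. f (T x))"
  unfolding bounded_measurable_def
  by (auto intro: measurable_compose dest: measurable_space)

lemma (in prob_space) bounded_measurable_integrable:
  assumes "bounded_measurable M f" shows "integrable M f"
proof -
  obtain B where "0 \<le> B" "\<And>x. x \<in> space M \<Longrightarrow> \<bar>f x\<bar> \<le> B" using bounded_measurable_bound[OF assms] by blast
  then show ?thesis
    using assms by (intro integrable_const_bound[where B=B] AE_I2) (auto intro: bounded_measurable_borel)
qed

lemma (in prob_space) bounded_measurable_integral_snd:
  assumes f: "bounded_measurable (N \<Otimes>\<^sub>M M) (\<lambda>(x, y). f x y)"
  shows "bounded_measurable N (\<lambda>x. \<integral>y. f x y \<partial>M)"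
proof -
  obtain B where B: "0 \<le> B" "\<And>p. p \<in> space (N \<Otimes>\<^sub>M M) \<Longrightarrow> \<bar>case p of (x, y) \<Rightarrow> f x y\<bar> \<le> B"
    using bounded_measurable_bound[OF f] by blast
  show ?thesis
  proof (rule bounded_measurableI[where B=B])
    show "(\<lambda>x. \<integral>y. f x y \<partial>M) \<in> borel_measurable N"
      using bounded_measurable_borel[OF f] by (rule borel_measurable_lebesgue_integral)
    fix x assume x: "x \<in> space N"
    have b: "\<bar>f x y\<bar> \<le> B" if "y \<in> space M" for y
      using B(2)[of "(x, y)"] x that by (simp add: space_pair_measure)
    have m: "(\<lambda>y. f x y) \<in> borel_measurable M"
      using measurable_compose_Pair1[OF x bounded_measurable_borel[OF f]] by simp
    have "integrable M (\<lambda>y. f x y)"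
      using b m by (intro integrable_const_bound[where B=B] AE_I2) auto
    then have "(\<integral>y. \<bar>f x y\<bar> \<partial>M) \<le> (\<integral>y. B \<partial>M)"
      using b by (intro integral_mono) auto
    also have "(\<integral>y. B \<partial>M) = B" by (simp add: prob_space)
    finally show "\<bar>\<integral>y. f x y \<partial>M\<bar> \<le> B"
      by (rule order.trans[OF integral_abs_bound])
  qed
qed

text \<open>
  The covariance of \<open>f\<close> and \<open>g\<close> under a probability measure \<open>P\<close>; \<open>covar P f f\<close> is the variance.
\<close>

definition covar :: "'a measure \<Rightarrow> ('a \<Rightarrow> real) \<Rightarrow> ('a \<Rightarrow> real) \<Rightarrow> real" where
  "covar P f g = (\<integral>x. f x * g x \<partial>P) - (\<integral>x. f x \<partial>P) * (\<integral>x. g x \<partial>P)"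

lemma (in prob_space) covar_self:
  assumes "bounded_measurable M f"
  shows "covar M f f = (\<integral>x. (f x - (\<integral>x. f x \<partial>M))\<^sup>2 \<partial>M)"
proof -
  have [simp]: "integrable M f" "integrable M (\<lambda>x. (f x)\<^sup>2)"
    using bounded_measurable_integrable[OF assms] bounded_measurable_integrable[OF bounded_measurable_mult[OF assms assms]]
    by (auto simp: power2_eq_square)
  show ?thesis
    using variance_eq[of f] by (simp add: covar_def flip: power2_eq_square)
qed

lemma (in prob_space) covar_self_nonneg:
  "bounded_measurable M f \<Longrightarrow> 0 \<le> covar M f f"
  by (simp add: covar_self)

lemma quadratic_nonneg_imp:
  fixes a b c :: real
  assumes nonneg: "\<And>l. 0 \<le> a + 2 * l * b + l\<^sup>2 * c" and "0 \<le> c"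
  shows "b\<^sup>2 \<le> a * c"
proof (cases "c = 0")
  case True
  have "b = 0"
  proof (rule ccontr)
    assume "b \<noteq> 0"
    with nonneg[of "- (a + 1) / (2 * b)"] True show False by (simp add: field_simps)
  qed
  with True show ?thesis by simp
next
  case False
  with \<open>0 \<le> c\<close> have "c > 0" by simp
  have "0 \<le> a - b\<^sup>2 / c"
    using nonneg[of "- b / c"] \<open>c > 0\<close> by (simp add: field_simps power2_eq_square)
  with \<open>c > 0\<close> show ?thesis by (simp add: field_simps)
qed

text \<open>Cauchy-Schwarz in the plane, with each product of squares replaced by an upper bound.\<close>

lemma sum_squared_le_prod_sums:
  fixes a b p q r s :: real
  assumes "a\<^sup>2 \<le> p * q" "b\<^sup>2 \<le> r * s" "0 \<le> p" "0 \<le> q" "0 \<le> r" "0 \<le> s"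
  shows "(a + b)\<^sup>2 \<le> (p + r) * (q + s)"
proof -
  have "(a * b)\<^sup>2 \<le> (p * q) * (r * s)"
    unfolding power_mult_distrib using assms by (intro mult_mono) auto
  moreover have "4 * ((p * q) * (r * s)) \<le> (p * s + r * q)\<^sup>2"
    using zero_le_power2[of "p * s - r * q"] by (simp add: power2_eq_square algebra_simps)
  ultimately have "(2 * a * b)\<^sup>2 \<le> (p * s + r * q)\<^sup>2"
    by (simp add: power_mult_distrib)
  then have "2 * a * b \<le> p * s + r * q"
    using assms by (intro power2_le_imp_le[of "2 * a * b"]) auto
  with assms show ?thesis by (simp add: power2_eq_square algebra_simps)
qed

section \<open>An additive bound for covariances on a product space\<close>

text \<open>On the space of \<open>P\<close>, the value \<open>g x\<close> is determined by the coordinates \<open>x i\<close> with \<open>i \<in> S\<close>.\<close>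

definition depends_on :: "'a set \<Rightarrow> ('a \<Rightarrow> 'b) measure \<Rightarrow> (('a \<Rightarrow> 'b) \<Rightarrow> real) \<Rightarrow> bool" where
  "depends_on S P g \<longleftrightarrow> (\<forall>x\<in>space P. \<forall>y\<in>space P. (\<forall>i\<in>S. x i = y i) \<longrightarrow> g x = g y)"

lemma depends_onI:
  "(\<And>x y. x \<in> space P \<Longrightarrow> y \<in> space P \<Longrightarrow> (\<And>i. i \<in> S \<Longrightarrow> x i = y i) \<Longrightarrow> g x = g y) \<Longrightarrow> depends_on S P g"
  unfolding depends_on_def by blast

lemma depends_onD:
  "depends_on S P g \<Longrightarrow> x \<in> space P \<Longrightarrow> y \<in> space P \<Longrightarrow> (\<And>i. i \<in> S \<Longrightarrow> x i = y i) \<Longrightarrow> g x = g y"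
  unfolding depends_on_def by blast

context
  fixes M :: "'i \<Rightarrow> 'a measure"
  assumes M: "\<And>i. prob_space (M i)"
begin

interpretation product_sigma_finite M
  using M by (simp add: product_sigma_finite_def prob_space_imp_sigma_finite)

text \<open>
  The mean of \<open>f\<close> over the coordinate \<open>i\<close>. For \<open>f\<close> on the product over \<open>insert i I\<close> it is a function on
  the product over \<open>I\<close>.
\<close>

definition coord_mean :: "'i \<Rightarrow> (('i \<Rightarrow> 'a) \<Rightarrow> real) \<Rightarrow> ('i \<Rightarrow> 'a) \<Rightarrow> real" where
  "coord_mean i f x = (\<integral>y. f (x(i := y)) \<partial>M i)"

lemma bounded_measurable_coord_mean:
  assumes "bounded_measurable (Pi\<^sub>M (insert i I) M) f"
  shows "bounded_measurable (Pi\<^sub>M I M) (coord_mean i f)"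
proof -
  have "bounded_measurable (Pi\<^sub>M I M \<Otimes>\<^sub>M M i) (\<lambda>p. f ((\<lambda>(x, y). x(i := y)) p))"
    by (rule bounded_measurable_compose[OF measurable_add_dim assms])
  then show ?thesis
    unfolding coord_mean_def
    by (intro prob_space.bounded_measurable_integral_snd[OF M]) (simp add: case_prod_beta')
qed

lemma bounded_measurable_update:
  assumes "bounded_measurable (Pi\<^sub>M (insert i I) M) f" "x \<in> space (Pi\<^sub>M I M)"
  shows "bounded_measurable (M i) (\<lambda>y. f (x(i := y)))"
proof -
  have "(\<lambda>y. (\<lambda>(x, y). x(i := y)) (x, y)) \<in> measurable (M i) (Pi\<^sub>M (insert i I) M)"
    using measurable_compose[OF measurable_Pair1'[OF assms(2)] measurable_add_dim] .
  from bounded_measurable_compose[OF this assms(1)] show ?thesis by simp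
qed

lemma integral_coord_mean:
  assumes "finite I" "i \<notin> I" "bounded_measurable (Pi\<^sub>M (insert i I) M) f"
  shows "(\<integral>x. f x \<partial>Pi\<^sub>M (insert i I) M) = (\<integral>x. coord_mean i f x \<partial>Pi\<^sub>M I M)"
  unfolding coord_mean_def
  using assms prob_space.bounded_measurable_integrable[OF prob_space_PiM[OF M] assms(3)]
  by (intro product_integral_insert) auto

lemma coord_mean_add_cmult:
  assumes f: "bounded_measurable (Pi\<^sub>M (insert i I) M) f" and g: "bounded_measurable (Pi\<^sub>M (insert i I) M) g"
    and x: "x \<in> space (Pi\<^sub>M I M)"
  shows "coord_mean i (\<lambda>x. f x + c * g x) x = coord_mean i f x + c * coord_mean i g x"
  using prob_space.bounded_measurable_integrable[OF M bounded_measurable_update[OF f x]]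
        prob_space.bounded_measurable_integrable[OF M bounded_measurable_update[OF g x]]
  by (simp add: coord_mean_def)

lemma integral_coord_mean_power2_le:
  assumes I: "finite I" "i \<notin> I" and f: "bounded_measurable (Pi\<^sub>M (insert i I) M) f"
  shows "(\<integral>x. (coord_mean i f x)\<^sup>2 \<partial>Pi\<^sub>M I M) \<le> (\<integral>x. (f x)\<^sup>2 \<partial>Pi\<^sub>M (insert i I) M)"
proof -
  have ff: "bounded_measurable (Pi\<^sub>M (insert i I) M) (\<lambda>x. (f x)\<^sup>2)"
    using bounded_measurable_mult[OF f f] by (simp add: power2_eq_square)
  note mf = bounded_measurable_coord_mean[OF f]
  have "(\<integral>x. (coord_mean i f x)\<^sup>2 \<partial>Pi\<^sub>M I M) \<le> (\<integral>x. coord_mean i (\<lambda>x. (f x)\<^sup>2) x \<partial>Pi\<^sub>M I M)"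
  proof (rule integral_mono)
    show "integrable (Pi\<^sub>M I M) (\<lambda>x. (coord_mean i f x)\<^sup>2)"
      using bounded_measurable_mult[OF mf mf]
      by (intro prob_space.bounded_measurable_integrable[OF prob_space_PiM[OF M]]) (simp add: power2_eq_square)
    show "integrable (Pi\<^sub>M I M) (coord_mean i (\<lambda>x. (f x)\<^sup>2))"
      by (intro prob_space.bounded_measurable_integrable[OF prob_space_PiM[OF M]] bounded_measurable_coord_mean ff)
    fix x assume x: "x \<in> space (Pi\<^sub>M I M)"
    show "(coord_mean i f x)\<^sup>2 \<le> coord_mean i (\<lambda>x. (f x)\<^sup>2) x"
      using prob_space.covar_self_nonneg[OF M bounded_measurable_update[OF f x]]
      by (simp add: covar_def coord_mean_def power2_eq_square)
  qed
  then show ?thesis using integral_coord_mean[OF I ff] by simp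
qed

text \<open>
  \<open>D u v\<close> is the expected covariance of \<open>u\<close> and \<open>v\<close> in the coordinate \<open>i\<close>, given all the others. It is a
  positive semidefinite bilinear form by \<open>integral_coord_mean_power2_le\<close>, and this is
  its Cauchy-Schwarz inequality.
\<close>

lemma coord_mean_Cauchy_Schwarz:
  assumes I: "finite I" "i \<notin> I"
    and f: "bounded_measurable (Pi\<^sub>M (insert i I) M) f" and g: "bounded_measurable (Pi\<^sub>M (insert i I) M) g"
  defines "D u v \<equiv> (\<integral>x. u x * v x \<partial>Pi\<^sub>M (insert i I) M)
                    - (\<integral>x. coord_mean i u x * coord_mean i v x \<partial>Pi\<^sub>M I M)"
  shows "(D f g)\<^sup>2 \<le> D f f * D g g"
proof (rule quadratic_nonneg_imp)
  show "0 \<le> D g g"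
    using integral_coord_mean_power2_le[OF I g] by (simp add: D_def power2_eq_square)
next
  fix l :: real
  interpret P: prob_space "Pi\<^sub>M (insert i I) M" by (rule prob_space_PiM[OF M])
  interpret Q: prob_space "Pi\<^sub>M I M" by (rule prob_space_PiM[OF M])
  note bm = bounded_measurable_mult bounded_measurable_add bounded_measurable_const bounded_measurable_coord_mean
  have [simp]: "integrable (Pi\<^sub>M (insert i I) M) (\<lambda>x. f x * f x)" "integrable (Pi\<^sub>M (insert i I) M) (\<lambda>x. f x * g x)"
    "integrable (Pi\<^sub>M (insert i I) M) (\<lambda>x. g x * g x)"
    by (intro P.bounded_measurable_integrable bm f g)+
  have [simp]: "integrable (Pi\<^sub>M I M) (\<lambda>x. coord_mean i f x * coord_mean i f x)"
    "integrable (Pi\<^sub>M I M) (\<lambda>x. coord_mean i f x * coord_mean i g x)"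
    "integrable (Pi\<^sub>M I M) (\<lambda>x. coord_mean i g x * coord_mean i g x)"
    by (intro Q.bounded_measurable_integrable bm f g)+
  have "(\<integral>x. (coord_mean i (\<lambda>x. f x + l * g x) x)\<^sup>2 \<partial>Pi\<^sub>M I M)
      \<le> (\<integral>x. (f x + l * g x)\<^sup>2 \<partial>Pi\<^sub>M (insert i I) M)"
    by (rule integral_coord_mean_power2_le[OF I]) (intro bm f g)
  also have "\<dots> = (\<integral>x. f x * f x + 2 * l * (f x * g x) + l\<^sup>2 * (g x * g x) \<partial>Pi\<^sub>M (insert i I) M)"
    by (rule Bochner_Integration.integral_cong) (auto simp: power2_eq_square algebra_simps)
  also have "(\<integral>x. (coord_mean i (\<lambda>x. f x + l * g x) x)\<^sup>2 \<partial>Pi\<^sub>M I M)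
      = (\<integral>x. coord_mean i f x * coord_mean i f x + 2 * l * (coord_mean i f x * coord_mean i g x)
             + l\<^sup>2 * (coord_mean i g x * coord_mean i g x) \<partial>Pi\<^sub>M I M)"
    by (rule Bochner_Integration.integral_cong) (auto simp: coord_mean_add_cmult[OF f g] power2_eq_square algebra_simps)
  finally have "(\<integral>x. coord_mean i f x * coord_mean i f x \<partial>Pi\<^sub>M I M)
        + 2 * l * (\<integral>x. coord_mean i f x * coord_mean i g x \<partial>Pi\<^sub>M I M)
        + l\<^sup>2 * (\<integral>x. coord_mean i g x * coord_mean i g x \<partial>Pi\<^sub>M I M)
      \<le> (\<integral>x. f x * f x \<partial>Pi\<^sub>M (insert i I) M)
        + 2 * l * (\<integral>x. f x * g x \<partial>Pi\<^sub>M (insert i I) M)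
        + l\<^sup>2 * (\<integral>x. g x * g x \<partial>Pi\<^sub>M (insert i I) M)"
    by simp
  then show "0 \<le> D f f + 2 * l * D f g + l\<^sup>2 * D g g"
    unfolding D_def right_diff_distrib by linarith
qed

lemma depends_on_coord_mean:
  assumes "depends_on S (Pi\<^sub>M (insert i I) M) g" "i \<notin> I"
  shows "depends_on (S - {i}) (Pi\<^sub>M I M) (coord_mean i g)"
proof (rule depends_onI)
  fix x y assume xy: "x \<in> space (Pi\<^sub>M I M)" "y \<in> space (Pi\<^sub>M I M)" and eq: "\<And>j. j \<in> S - {i} \<Longrightarrow> x j = y j"
  show "coord_mean i g x = coord_mean i g y"
    unfolding coord_mean_def
  proof (rule Bochner_Integration.integral_cong[OF refl])
    fix t assume "t \<in> space (M i)"
    with xy have "x(i := t) \<in> space (Pi\<^sub>M (insert i I) M)" "y(i := t) \<in> space (Pi\<^sub>M (insert i I) M)"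
      by (simp_all add: space_PiM PiE_fun_upd)
    then show "g (x(i := t)) = g (y(i := t))"
      by (rule depends_onD[OF assms(1)]) (use eq in auto)
  qed
qed

text \<open>The form \<open>D f g\<close> of the preceding lemma vanishes when \<open>g\<close> does not depend on the coordinate \<open>i\<close>.\<close>

lemma integral_mult_coord_mean_if_not_depends:
  assumes I: "finite I" "i \<notin> I"
    and f: "bounded_measurable (Pi\<^sub>M (insert i I) M) f" and g: "bounded_measurable (Pi\<^sub>M (insert i I) M) g"
    and dep: "depends_on S (Pi\<^sub>M (insert i I) M) g" "i \<notin> S"
  shows "(\<integral>x. f x * g x \<partial>Pi\<^sub>M (insert i I) M) = (\<integral>x. coord_mean i f x * coord_mean i g x \<partial>Pi\<^sub>M I M)"
proof -
  have "(\<integral>x. f x * g x \<partial>Pi\<^sub>M (insert i I) M) = (\<integral>x. coord_mean i (\<lambda>x. f x * g x) x \<partial>Pi\<^sub>M I M)"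
    by (intro integral_coord_mean I bounded_measurable_mult f g)
  also have "\<dots> = (\<integral>x. coord_mean i f x * coord_mean i g x \<partial>Pi\<^sub>M I M)"
  proof (rule Bochner_Integration.integral_cong[OF refl])
    fix x assume x: "x \<in> space (Pi\<^sub>M I M)"
    have sp: "x(i := t) \<in> space (Pi\<^sub>M (insert i I) M)" if "t \<in> space (M i)" for t
      using x that by (simp add: space_PiM PiE_fun_upd)
    have g_eq: "g (x(i := t)) = coord_mean i g x" if t: "t \<in> space (M i)" for t
    proof -
      have "coord_mean i g x = (\<integral>u. g (x(i := t)) \<partial>M i)"
        unfolding coord_mean_def
        by (intro Bochner_Integration.integral_cong refl depends_onD[OF dep(1)] sp t)
          (use dep(2) in auto)
      then show ?thesis by (simp add: prob_space.prob_space[OF M])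
    qed
    have "coord_mean i (\<lambda>x. f x * g x) x = (\<integral>t. f (x(i := t)) * coord_mean i g x \<partial>M i)"
      unfolding coord_mean_def[of i "\<lambda>x. f x * g x"]
      by (intro Bochner_Integration.integral_cong) (simp_all add: g_eq)
    then show "coord_mean i (\<lambda>x. f x * g x) x = coord_mean i f x * coord_mean i g x"
      by (simp add: coord_mean_def)
  qed
  finally show ?thesis .
qed

text \<open>
  The weights \<open>d\<close> depend on \<open>f\<close> but neither on \<open>S\<close> nor on \<open>g\<close>, which is what makes the sum over all
  subsets \<open>S\<close> tractable later on.
\<close>

lemma additive_covariance_bound:
  assumes "finite I" "bounded_measurable (Pi\<^sub>M I M) f"
  shows "\<exists>d. (\<forall>i. 0 \<le> d i) \<and> sum d I \<le> covar (Pi\<^sub>M I M) f f \<and>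
     (\<forall>S g. S \<subseteq> I \<longrightarrow> bounded_measurable (Pi\<^sub>M I M) g \<longrightarrow> depends_on S (Pi\<^sub>M I M) g \<longrightarrow>
        (covar (Pi\<^sub>M I M) f g)\<^sup>2 \<le> sum d S * covar (Pi\<^sub>M I M) g g)"
  using assms
proof (induction I arbitrary: f rule: finite_induct)
  case empty
  interpret P: prob_space "Pi\<^sub>M {} M" by (rule prob_space_PiM[OF M])
  have "covar (Pi\<^sub>M {} M) f g = 0" if "depends_on {} (Pi\<^sub>M {} M) g" for g
  proof -
    obtain x0 where "x0 \<in> space (Pi\<^sub>M {} M)" using P.not_empty by blast
    then have c: "g x = g x0" if "x \<in> space (Pi\<^sub>M {} M)" for x
      using depends_onD[OF \<open>depends_on {} (Pi\<^sub>M {} M) g\<close> that] by simp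
    have "(\<integral>x. f x * g x \<partial>Pi\<^sub>M {} M) = (\<integral>x. f x * g x0 \<partial>Pi\<^sub>M {} M)"
      "(\<integral>x. g x \<partial>Pi\<^sub>M {} M) = (\<integral>x. g x0 \<partial>Pi\<^sub>M {} M)"
      by (intro Bochner_Integration.integral_cong refl arg_cong2[of _ _ _ _ "(*)"] c; assumption)+
    then show ?thesis by (simp add: covar_def P.prob_space)
  qed
  with P.covar_self_nonneg[OF empty] show ?case
    by (intro exI[of _ "\<lambda>_. 0"]) auto
next
  case (insert i I)
  let ?P = "Pi\<^sub>M (insert i I) M" and ?Q = "Pi\<^sub>M I M" and ?m = "coord_mean i"
  interpret P: prob_space ?P by (rule prob_space_PiM[OF M])
  interpret Q: prob_space ?Q by (rule prob_space_PiM[OF M])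
  note I = insert.hyps
  note f = insert.prems
  define D where "D u v = (\<integral>x. u x * v x \<partial>?P) - (\<integral>x. ?m u x * ?m v x \<partial>?Q)" for u v
  \<comment> \<open>The law of total covariance, conditioning on the coordinates in \<open>I\<close>.\<close>
  have split: "covar ?P u v = covar ?Q (?m u) (?m v) + D u v"
    if "bounded_measurable ?P u" "bounded_measurable ?P v" for u v
    unfolding covar_def D_def
      integral_coord_mean[OF I that(1)] integral_coord_mean[OF I that(2)] by simp
  have D_nonneg: "0 \<le> D u u" if "bounded_measurable ?P u" for u
    using integral_coord_mean_power2_le[OF I that] by (simp add: D_def power2_eq_square)
  obtain d where d: "\<And>i. 0 \<le> d i" "sum d I \<le> covar ?Q (?m f) (?m f)"
    "\<And>S g. S \<subseteq> I \<Longrightarrow> bounded_measurable ?Q g \<Longrightarrow> depends_on S ?Q g \<Longrightarrow>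
        (covar ?Q (?m f) g)\<^sup>2 \<le> sum d S * covar ?Q g g"
    using insert.IH[OF bounded_measurable_coord_mean[OF f]] by blast
  \<comment> \<open>The weight of the new coordinate is the part of the variance of \<open>f\<close> lost by integrating it out.\<close>
  define d' where "d' = d(i := D f f)"
  have d'_nonneg: "0 \<le> d' j" for j
    using d(1) D_nonneg[OF f] by (simp add: d'_def)
  have sum_d': "sum d' T = sum d T" if "i \<notin> T" for T
    using that by (auto simp: d'_def intro!: sum.cong)
  have "sum d' (insert i I) \<le> covar ?P f f"
    using I d(2) split[OF f f] sum_d'[OF I(2)] by (simp add: d'_def)
  moreover have "(covar ?P f g)\<^sup>2 \<le> sum d' S * covar ?P g g"
    if S: "S \<subseteq> insert i I" and g: "bounded_measurable ?P g" and dep: "depends_on S ?P g" for S g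
  proof -
    let ?r = "if i \<in> S then D f f else 0"
    have IH: "(covar ?Q (?m f) (?m g))\<^sup>2 \<le> sum d (S - {i}) * covar ?Q (?m g) (?m g)"
      using S by (intro d(3) bounded_measurable_coord_mean g depends_on_coord_mean dep I) auto
    have "(D f g)\<^sup>2 \<le> ?r * D g g"
      using coord_mean_Cauchy_Schwarz[OF I f g] integral_mult_coord_mean_if_not_depends[OF I f g dep]
      by (simp add: D_def)
    from sum_squared_le_prod_sums[OF IH this]
    have "(covar ?P f g)\<^sup>2 \<le> (sum d (S - {i}) + ?r) * covar ?P g g"
      using split[OF f g] split[OF g g] d(1) D_nonneg[OF f] D_nonneg[OF g]
        Q.covar_self_nonneg[OF bounded_measurable_coord_mean[OF g]]
      by (simp add: sum_nonneg)
    moreover have "sum d' S = sum d (S - {i}) + ?r"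
    proof (cases "i \<in> S")
      case True
      with S I(1) have "sum d' S = d' i + sum d' (S - {i})" by (intro sum.remove) (auto intro: finite_subset)
      with True show ?thesis by (simp add: sum_d') (simp add: d'_def)
    qed (simp add: sum_d')
    ultimately show ?thesis by simp
  qed
  ultimately show ?case using d'_nonneg by blast
qed

section \<open>Variances of marginal means\<close>

text \<open>
  The mean of \<open>f\<close>, a function on the product over \<open>I\<close>, given the coordinates in \<open>S\<close>: a function on the
  product over \<open>S\<close>, in which the coordinates in \<open>I - S\<close> have been integrated out.
\<close>

definition marginal_mean :: "'i set \<Rightarrow> 'i set \<Rightarrow> (('i \<Rightarrow> 'a) \<Rightarrow> real) \<Rightarrow> ('i \<Rightarrow> 'a) \<Rightarrow> real" where
  "marginal_mean I S f x = (\<integral>y. f (merge S (I - S) (x, y)) \<partial>Pi\<^sub>M (I - S) M)"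

lemma bounded_measurable_marginal_mean:
  assumes "S \<subseteq> I" "bounded_measurable (Pi\<^sub>M I M) f"
  shows "bounded_measurable (Pi\<^sub>M S M) (marginal_mean I S f)"
proof -
  have "S \<union> (I - S) = I" using assms by auto
  then have "bounded_measurable (Pi\<^sub>M S M \<Otimes>\<^sub>M Pi\<^sub>M (I - S) M) (\<lambda>p. f (merge S (I - S) p))"
    using measurable_merge[of S "I - S" M] by (intro bounded_measurable_compose[OF _ assms(2)]) simp
  then show ?thesis
    unfolding marginal_mean_def
    by (intro prob_space.bounded_measurable_integral_snd[OF prob_space_PiM[OF M]]) (simp add: case_prod_beta')
qed

lemma integral_marginal_mean:
  assumes "finite I" "S \<subseteq> I" "bounded_measurable (Pi\<^sub>M I M) f"
  shows "(\<integral>x. f x \<partial>Pi\<^sub>M I M) = (\<integral>x. marginal_mean I S f x \<partial>Pi\<^sub>M S M)"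
proof -
  have I: "S \<union> (I - S) = I" using assms by auto
  have "integrable (Pi\<^sub>M I M) f"
    using prob_space.bounded_measurable_integrable[OF prob_space_PiM[OF M] assms(3)] .
  then show ?thesis
    using product_integral_fold[of S "I - S" f] assms I finite_subset[OF assms(2,1)]
    by (simp add: marginal_mean_def)
qed

lemma marginal_mean_mult_restrict:
  assumes "x \<in> space (Pi\<^sub>M S M)"
  shows "marginal_mean I S (\<lambda>z. f z * G (restrict z S)) x = marginal_mean I S f x * G x"
proof -
  have "restrict (merge S (I - S) (x, y)) S = x" for y
    using assms by (auto simp: merge_def space_PiM fun_eq_iff PiE_def extensional_def)
  then show ?thesis by (simp add: marginal_mean_def)
qed

lemma additive_marginal_variance_bound:
  assumes I: "finite I" and f: "bounded_measurable (Pi\<^sub>M I M) f"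
  obtains d where "\<And>i. 0 \<le> d i" "sum d I \<le> covar (Pi\<^sub>M I M) f f"
    "\<And>S. S \<subseteq> I \<Longrightarrow> covar (Pi\<^sub>M S M) (marginal_mean I S f) (marginal_mean I S f) \<le> sum d S"
proof -
  obtain d where d: "\<And>i. 0 \<le> d i" "sum d I \<le> covar (Pi\<^sub>M I M) f f"
    "\<And>S g. S \<subseteq> I \<Longrightarrow> bounded_measurable (Pi\<^sub>M I M) g \<Longrightarrow> depends_on S (Pi\<^sub>M I M) g \<Longrightarrow>
        (covar (Pi\<^sub>M I M) f g)\<^sup>2 \<le> sum d S * covar (Pi\<^sub>M I M) g g"
    using additive_covariance_bound[OF assms] by blast
  have "covar (Pi\<^sub>M S M) (marginal_mean I S f) (marginal_mean I S f) \<le> sum d S" if S: "S \<subseteq> I" for S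
  proof -
    let ?F = "marginal_mean I S f"
    \<comment> \<open>For the marginal mean, lifted to the full product, covariance with \<open>f\<close> and variance agree.\<close>
    define g where "g x = ?F (restrict x S)" for x
    interpret I: prob_space "Pi\<^sub>M I M" by (rule prob_space_PiM[OF M])
    interpret S: prob_space "Pi\<^sub>M S M" by (rule prob_space_PiM[OF M])
    note F = bounded_measurable_marginal_mean[OF S f]
    have g: "bounded_measurable (Pi\<^sub>M I M) g"
      unfolding g_def using S by (intro bounded_measurable_compose[OF measurable_restrict_subset F])
    have integral_g: "(\<integral>x. u x * G (restrict x S) \<partial>Pi\<^sub>M I M) = (\<integral>x. marginal_mean I S u x * G x \<partial>Pi\<^sub>M S M)"
      if u: "bounded_measurable (Pi\<^sub>M I M) u" and G: "bounded_measurable (Pi\<^sub>M S M) G" for u G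
    proof -
      have "bounded_measurable (Pi\<^sub>M I M) (\<lambda>x. G (restrict x S))"
        using S by (intro bounded_measurable_compose[OF measurable_restrict_subset G])
      then have "(\<integral>x. u x * G (restrict x S) \<partial>Pi\<^sub>M I M)
          = (\<integral>x. marginal_mean I S (\<lambda>z. u z * G (restrict z S)) x \<partial>Pi\<^sub>M S M)"
        by (intro integral_marginal_mean I S bounded_measurable_mult u)
      also have "\<dots> = (\<integral>x. marginal_mean I S u x * G x \<partial>Pi\<^sub>M S M)"
        by (intro Bochner_Integration.integral_cong refl marginal_mean_mult_restrict)
      finally show ?thesis .
    qed
    have one: "marginal_mean I S (\<lambda>_. 1) x = 1" for x
      by (simp add: marginal_mean_def prob_space.prob_space[OF prob_space_PiM[OF M]])
    have integral_1: "(\<integral>x. G (restrict x S) \<partial>Pi\<^sub>M I M) = (\<integral>x. G x \<partial>Pi\<^sub>M S M)"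
      if "bounded_measurable (Pi\<^sub>M S M) G" for G
      using integral_g[OF bounded_measurable_const[of _ 1] that] by (simp add: one)
    have cov: "covar (Pi\<^sub>M I M) f g = covar (Pi\<^sub>M S M) ?F ?F" "covar (Pi\<^sub>M I M) g g = covar (Pi\<^sub>M S M) ?F ?F"
      using integral_g[OF f F] integral_1[OF F] integral_1[OF bounded_measurable_mult[OF F F]] integral_marginal_mean[OF I S f]
      by (simp_all add: covar_def g_def)
    have "depends_on S (Pi\<^sub>M I M) g"
      unfolding g_def by (intro depends_onI arg_cong[of _ _ ?F]) (auto simp: restrict_def)
    from d(3)[OF S g this]
    have "covar (Pi\<^sub>M S M) ?F ?F * covar (Pi\<^sub>M S M) ?F ?F \<le> sum d S * covar (Pi\<^sub>M S M) ?F ?F"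
      unfolding cov by (simp add: power2_eq_square)
    with S.covar_self_nonneg[OF F] sum_nonneg[of S d, OF d(1)] show ?thesis
      by (cases "covar (Pi\<^sub>M S M) ?F ?F = 0") (auto simp: mult_le_cancel_right)
  qed
  with d(1,2) that show ?thesis by blast
qed

end

section \<open>Change of an integral bounded by the chi-squared divergence\<close>

text \<open>
  Writing \<open>L\<close> for the density of \<open>N\<close> with respect to \<open>P\<close>, the difference of the integrals of \<open>F\<close> is the
  \<open>P\<close>-integral of \<open>(F - c) * (L - 1)\<close> for every constant \<open>c\<close>; the mean of \<open>F\<close> is the best choice. Finiteness
  of the divergence cannot be dropped: without absolute continuity the left-hand side may be positive
  although \<open>F\<close> has zero variance under \<open>P\<close>, and \<open>0 * \<infinity> = 0\<close>.
\<close>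

lemma chi2_div_integral_bound:
  assumes P: "prob_space P" and N: "prob_space N" and sets: "sets N = sets P"
    and F: "bounded_measurable P F" and fin: "chi2_div N P \<noteq> \<infinity>"
  shows "ennreal (((\<integral>x. F x \<partial>P) - (\<integral>x. F x \<partial>N))\<^sup>2) \<le> ennreal (covar P F F) * chi2_div N P"
proof -
  interpret P: prob_space P by fact
  interpret N: prob_space N by fact
  have ac: "absolutely_continuous P N" using fin by (auto simp: chi2_div_def split: if_splits)
  define L where "L x = enn2real (RN_deriv P N x)" for x
  define c where "c = (\<integral>x. F x \<partial>P)"
  have [measurable]: "F \<in> borel_measurable P"
    using F by (rule bounded_measurable_borel)
  have [measurable]: "L \<in> borel_measurable P"
    unfolding L_def by measurable
  have L_nonneg: "0 \<le> L x" for x by (simp add: L_def)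
  have "N = density P (RN_deriv P N)" using P.density_RN_deriv[OF ac sets] by simp
  also have "\<dots> = density P (\<lambda>x. ennreal (L x))"
    using P.RN_deriv_finite[OF N.sigma_finite_measure_axioms ac sets]
    by (intro density_cong) (auto simp: L_def less_top)
  finally have N_eq: "N = density P (\<lambda>x. ennreal (L x))" .
  have integral_N: "(\<integral>x. G x \<partial>N) = (\<integral>x. L x * G x \<partial>P)" if "G \<in> borel_measurable P" for G :: "'a \<Rightarrow> real"
    using that L_nonneg by (subst N_eq, subst integral_density) auto
  have iL': "integrable P (\<lambda>x. L x * G x)" if "bounded_measurable P G" for G
  proof -
    have [measurable]: "G \<in> borel_measurable P" using that by (rule bounded_measurable_borel)
    have "bounded_measurable N G"
      using that sets sets_eq_imp_space_eq[OF sets] by (auto simp: bounded_measurable_def cong: measurable_cong_sets)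
    then have "integrable N G" by (rule N.bounded_measurable_integrable)
    then show ?thesis using L_nonneg by (subst (asm) N_eq, subst (asm) integrable_density) auto
  qed
  have iL: "integrable P L" using iL'[OF bounded_measurable_const[of _ 1]] by simp
  have L1: "(\<integral>x. L x \<partial>P) = 1"
    using integral_N[of "\<lambda>_. 1"] N.prob_space by simp
  have iF: "integrable P F" using P.bounded_measurable_integrable[OF F] .
  have "(\<integral>x. F x \<partial>N) - (\<integral>x. F x \<partial>P) = (\<integral>x. (F x - c) * (L x - 1) \<partial>P)"
  proof -
    have "(\<integral>x. (F x - c) * (L x - 1) \<partial>P) = (\<integral>x. L x * F x - F x - c * L x + c \<partial>P)"
      by (intro Bochner_Integration.integral_cong) (auto simp: algebra_simps)
    also have "\<dots> = (\<integral>x. L x * F x \<partial>P) - c"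
      using iL'[OF F] iF iL by (simp add: c_def L1 P.prob_space)
    finally show ?thesis by (simp add: integral_N c_def)
  qed
  then have "ennreal (((\<integral>x. F x \<partial>P) - (\<integral>x. F x \<partial>N))\<^sup>2) = (ennreal \<bar>\<integral>x. (F x - c) * (L x - 1) \<partial>P\<bar>)\<^sup>2"
    by (simp add: ennreal_power power2_commute)
  also have "\<dots> \<le> (\<integral>\<^sup>+x. ennreal \<bar>(F x - c) * (L x - 1)\<bar> \<partial>P)\<^sup>2"
  proof (intro power_mono)
    have "integrable P (\<lambda>x. (F x - c) * (L x - 1))"
      using iL'[OF F] iF iL by (simp add: algebra_simps)
    from integral_norm_bound_ennreal[OF this]
    show "ennreal \<bar>\<integral>x. (F x - c) * (L x - 1) \<partial>P\<bar> \<le> (\<integral>\<^sup>+x. ennreal \<bar>(F x - c) * (L x - 1)\<bar> \<partial>P)" by simp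
  qed simp
  also have "\<dots> = (\<integral>\<^sup>+x. ennreal \<bar>F x - c\<bar> * ennreal \<bar>L x - 1\<bar> \<partial>P)\<^sup>2"
    by (simp add: abs_mult ennreal_mult)
  also have "\<dots> \<le> (\<integral>\<^sup>+x. (ennreal \<bar>F x - c\<bar>)\<^sup>2 \<partial>P) * (\<integral>\<^sup>+x. (ennreal \<bar>L x - 1\<bar>)\<^sup>2 \<partial>P)"
    by (intro Cauchy_Schwarz_nn_integral) auto
  also have "(\<integral>\<^sup>+x. (ennreal \<bar>L x - 1\<bar>)\<^sup>2 \<partial>P) = chi2_div N P"
    using ac by (simp add: chi2_div_def L_def ennreal_power)
  also have "(\<integral>\<^sup>+x. (ennreal \<bar>F x - c\<bar>)\<^sup>2 \<partial>P) = ennreal (covar P F F)"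
  proof -
    have "bounded_measurable P (\<lambda>x. F x + (- c))" by (intro bounded_measurable_add F bounded_measurable_const)
    from bounded_measurable_mult[OF this this] have "integrable P (\<lambda>x. (F x - c)\<^sup>2)"
      by (intro P.bounded_measurable_integrable) (simp add: power2_eq_square)
    then show ?thesis
      by (simp add: ennreal_power P.covar_self[OF F] c_def[symmetric] nn_integral_eq_integral)
  qed
  finally show ?thesis .
qed


section \<open>Counting subsets, and functions with values in the unit interval\<close>

lemma sum_over_subsets_of_card:
  fixes d :: "nat \<Rightarrow> real"
  assumes "1 \<le> s" "s \<le> n"
  shows "(\<Sum>S | S \<subseteq> {1..n} \<and> card S = s. sum d S) = real (n choose s) * (real s / real n) * sum d {1..n}"
proof -
  let ?F = "{S. S \<subseteq> {1..n} \<and> card S = s}"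
  have fin: "finite ?F" by (rule finite_subset[of _ "Pow {1..n}"]) auto
  have card: "card {S \<in> ?F. i \<in> S} = (n - 1) choose (s - 1)" if i: "i \<in> {1..n}" for i
  proof -
    have "bij_betw (insert i) {T. T \<subseteq> {1..n} - {i} \<and> card T = s - 1} {S \<in> ?F. i \<in> S}"
    proof (rule bij_betwI[where g="\<lambda>S. S - {i}"])
      show "insert i \<in> {T. T \<subseteq> {1..n} - {i} \<and> card T = s - 1} \<rightarrow> {S \<in> ?F. i \<in> S}"
      proof
        fix T assume T: "T \<in> {T. T \<subseteq> {1..n} - {i} \<and> card T = s - 1}"
        then have "finite T" "i \<notin> T" by (auto intro: finite_subset)
        with T i assms(1) show "insert i T \<in> {S \<in> ?F. i \<in> S}" by auto
      qed
      show "(\<lambda>S. S - {i}) \<in> {S \<in> ?F. i \<in> S} \<rightarrow> {T. T \<subseteq> {1..n} - {i} \<and> card T = s - 1}"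
        by auto
    qed auto
    then show ?thesis
      using n_subsets[of "{1..n} - {i}" "s - 1"] i by (simp add: bij_betw_same_card[symmetric])
  qed
  have "(\<Sum>S\<in>?F. sum d S) = (\<Sum>S\<in>?F. \<Sum>i\<in>{1..n}. if i \<in> S then d i else 0)"
    by (intro sum.cong refl sum.mono_neutral_cong_left) auto
  also have "\<dots> = (\<Sum>i\<in>{1..n}. \<Sum>S\<in>?F. if i \<in> S then d i else 0)"
    by (rule sum.swap)
  also have "\<dots> = (\<Sum>i\<in>{1..n}. real ((n - 1) choose (s - 1)) * d i)"
    using fin card by (intro sum.cong refl) (simp add: sum.If_cases Int_def)
  also have "\<dots> = real ((n - 1) choose (s - 1)) * sum d {1..n}"
    by (simp add: sum_distrib_left)
  also have "real ((n - 1) choose (s - 1)) = real (n choose s) * (real s / real n)"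
    using times_binomial_minus1_eq[of s n] assms
    by (simp add: field_simps flip: of_nat_mult)
  finally show ?thesis .
qed

lemma covar_self_le_quarter:
  assumes P: "prob_space P" and f: "f \<in> borel_measurable P" "\<And>x. x \<in> space P \<Longrightarrow> f x \<in> {0..1}"
  shows "covar P f f \<le> 1 / 4"
proof -
  interpret prob_space P by fact
  have b: "bounded_measurable P f"
    using f by (intro bounded_measurableI[where B=1]) auto
  let ?m = "\<integral>x. f x \<partial>P"
  have "(\<integral>x. f x * f x \<partial>P) \<le> ?m"
    using f(2) by (intro integral_mono bounded_measurable_integrable bounded_measurable_mult b) (auto intro: mult_left_le)
  moreover have "?m - ?m * ?m \<le> 1 / 4"
    using zero_le_power2[of "?m - 1 / 2"] by (simp add: power2_eq_square algebra_simps)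
  ultimately show ?thesis by (simp add: covar_def)
qed

section \<open>The smoothed algorithm\<close>

lemma sets_noise [measurable_cong]: "sets (noise h I) = sets (vec_borel I)"
  unfolding noise_def by (intro sets_PiM_cong) auto

context
  fixes h :: "real \<Rightarrow> real"
  assumes h_borel: "h \<in> borel_measurable borel"
    and h_total: "(\<integral>\<^sup>+ t. ennreal (h t) \<partial>lborel) = 1"
begin

lemma prob_space_noise_coord: "prob_space (density lborel (\<lambda>t. ennreal (h t)))"
  using h_borel h_total by (intro prob_spaceI) (simp add: emeasure_density)

lemma prob_space_noise: "prob_space (noise h I)"
  unfolding noise_def by (rule prob_space_PiM[OF prob_space_noise_coord])

lemma bounded_measurable_smoothed_integrand:
  assumes A: "bounded_measurable (vec_borel {1..n}) A" and z: "z \<in> space (vec_borel {1..n})"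
  shows "bounded_measurable (noise h {1..n}) (\<lambda>\<xi>. A (\<lambda>i\<in>{1..n}. z i + \<xi> i))"
  by (rule bounded_measurable_compose[OF _ A]) measurable

lemma bounded_measurable_smoothed:
  assumes A: "bounded_measurable (vec_borel {1..n}) A"
  shows "bounded_measurable (vec_borel {1..n}) (smoothed h n A)"
proof -
  have "bounded_measurable (vec_borel {1..n} \<Otimes>\<^sub>M noise h {1..n}) (\<lambda>p. A (\<lambda>i\<in>{1..n}. fst p i + snd p i))"
    by (rule bounded_measurable_compose[OF _ A]) measurable
  then show ?thesis
    unfolding smoothed_def[abs_def]
    by (intro prob_space.bounded_measurable_integral_snd[OF prob_space_noise]) (simp add: case_prod_beta')
qed

lemma smoothed_diff_bound:
  assumes A: "bounded_measurable (vec_borel {1..n}) A" and z: "z \<in> space (vec_borel {1..n})"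
    and S: "S \<subseteq> {1..n}"
    and fin: "shift_chi2 h S (\<lambda>i\<in>S. \<zeta> i - z i) \<noteq> \<infinity>"
  defines "F \<equiv> marginal_mean (\<lambda>_. density lborel (\<lambda>t. ennreal (h t))) {1..n} S (\<lambda>\<xi>. A (\<lambda>i\<in>{1..n}. z i + \<xi> i))"
  shows "ennreal ((smoothed h n A z - smoothed h n A (resample n S z \<zeta>))\<^sup>2)
     \<le> ennreal (covar (noise h S) F F) * shift_chi2 h S (\<lambda>i\<in>S. \<zeta> i - z i)"
proof -
  let ?M = "\<lambda>_::nat. density lborel (\<lambda>t. ennreal (h t))"
  let ?T = "\<lambda>w. \<lambda>i\<in>S. (\<lambda>i\<in>S. \<zeta> i - z i) i + w i"
  let ?N = "distr (noise h S) (vec_borel S) ?T"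
  let ?f = "\<lambda>\<xi>. A (\<lambda>i\<in>{1..n}. z i + \<xi> i)"
  let ?r = "resample n S z \<zeta>"
  have T[measurable]: "?T \<in> measurable (noise h S) (vec_borel S)" by measurable
  have r: "?r \<in> space (vec_borel {1..n})" by (simp add: resample_def space_PiM)
  note f = bounded_measurable_smoothed_integrand[OF A z, unfolded noise_def]
  note f' = bounded_measurable_smoothed_integrand[OF A r, unfolded noise_def]
  have F: "bounded_measurable (noise h S) F"
    unfolding F_def noise_def
    by (rule bounded_measurable_marginal_mean[OF prob_space_noise_coord S f])
  have F_borel: "F \<in> borel_measurable (vec_borel S)"
    using bounded_measurable_borel[OF F] by (simp cong: measurable_cong_sets add: sets_noise)
  have "smoothed h n A z = (\<integral>x. F x \<partial>noise h S)"
    unfolding smoothed_def noise_def F_def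
    by (rule integral_marginal_mean[OF prob_space_noise_coord _ S f]) simp
  moreover have "smoothed h n A ?r = (\<integral>x. F x \<partial>?N)"
  proof -
    have "smoothed h n A ?r = (\<integral>x. marginal_mean ?M {1..n} S (\<lambda>\<xi>. A (\<lambda>i\<in>{1..n}. ?r i + \<xi> i)) x \<partial>noise h S)"
      unfolding smoothed_def noise_def
      by (rule integral_marginal_mean[OF prob_space_noise_coord _ S f']) simp
    also have "\<dots> = (\<integral>x. F (?T x) \<partial>noise h S)"
    proof (intro Bochner_Integration.integral_cong refl)
      fix x
      \<comment> \<open>Resampling the coordinates in \<open>S\<close> amounts to shifting the noise on \<open>S\<close> and leaving the rest alone.\<close>
      have "(\<lambda>i\<in>{1..n}. ?r i + merge S ({1..n} - S) (x, y) i)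
          = (\<lambda>i\<in>{1..n}. z i + merge S ({1..n} - S) (?T x, y) i)" for y
        using S by (auto simp: fun_eq_iff resample_def merge_def indicator_def)
      then show "marginal_mean ?M {1..n} S (\<lambda>\<xi>. A (\<lambda>i\<in>{1..n}. ?r i + \<xi> i)) x = F (?T x)"
        unfolding F_def marginal_mean_def[OF prob_space_noise_coord] by simp
    qed
    also have "\<dots> = (\<integral>x. F x \<partial>?N)"
      by (rule integral_distr[symmetric, OF T F_borel])
    finally show ?thesis .
  qed
  ultimately show ?thesis
    unfolding shift_chi2_def
    using fin prob_space.prob_space_distr[OF prob_space_noise T]
    by (auto intro!: chi2_div_integral_bound prob_space_noise F simp: shift_chi2_def sets_noise)
qed

text \<open>
  The claim before taking expectations over \<open>Z\<close> and \<open>\<zeta>\<close>. The constants stand on the left so that the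
  right-hand side, whose measurability is not established, can be integrated as it is.
\<close>

lemma smoothed_resample_pointwise:
  assumes s: "1 \<le> s" "s \<le> n"
    and A: "A \<in> borel_measurable (vec_borel {1..n})" "A \<in> space (vec_borel {1..n}) \<rightarrow> {0..1}"
    and z: "z \<in> space (vec_borel {1..n})"
  shows "ennreal (4 * real n / real s / real (n choose s) *
       (\<Sum>S | S \<subseteq> {1..n} \<and> card S = s. (smoothed h n A z - smoothed h n A (resample n S z \<zeta>))\<^sup>2))
     \<le> (MAX S\<in>{S. S \<subseteq> {1..n} \<and> card S = s}. shift_chi2 h S (\<lambda>i\<in>S. \<zeta> i - z i))"
    (is "ennreal (?c * (\<Sum>S\<in>?F. ?D S)) \<le> (MAX S\<in>?F. ?X S)")
proof -
  let ?M = "\<lambda>_::nat. density lborel (\<lambda>t. ennreal (h t))"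
  let ?f = "\<lambda>\<xi>. A (\<lambda>i\<in>{1..n}. z i + \<xi> i)"
  define m where "m = (MAX S\<in>?F. ?X S)"
  have fin: "finite ?F" by (rule finite_subset[of _ "Pow {1..n}"]) auto
  have X_le: "?X S \<le> m" if "S \<in> ?F" for S
    unfolding m_def using fin that by (intro Max_ge) auto
  have Ab: "bounded_measurable (vec_borel {1..n}) A"
    using A by (intro bounded_measurableI[where B=1]) (auto simp: Pi_iff)
  note f = bounded_measurable_smoothed_integrand[OF Ab z, unfolded noise_def]
  have "ennreal (?c * (\<Sum>S\<in>?F. ?D S)) \<le> m"
  \<comment> \<open>An infinite divergence makes the bound trivial, so absolute continuity may be assumed for all \<open>S\<close>.\<close>
  proof (cases "m = \<infinity>")
    case False
    obtain d where d: "\<And>i. 0 \<le> d i" "sum d {1..n} \<le> covar (noise h {1..n}) ?f ?f"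
      "\<And>S. S \<subseteq> {1..n} \<Longrightarrow> covar (noise h S) (marginal_mean ?M {1..n} S ?f) (marginal_mean ?M {1..n} S ?f) \<le> sum d S"
      using additive_marginal_variance_bound[OF prob_space_noise_coord _ f] unfolding noise_def by auto
    have "covar (noise h {1..n}) ?f ?f \<le> 1 / 4"
    proof (rule covar_self_le_quarter[OF prob_space_noise])
      show "?f \<in> borel_measurable (noise h {1..n})"
        using f unfolding noise_def by (rule bounded_measurable_borel)
      show "?f \<xi> \<in> {0..1}" for \<xi>
        using A(2) by (auto simp: Pi_iff space_PiM)
    qed
    with d(2) have d_quarter: "sum d {1..n} \<le> 1 / 4" by simp
    have D_le: "ennreal (?D S) \<le> ennreal (sum d S) * m" if "S \<in> ?F" for S
    proof -
      have S: "S \<subseteq> {1..n}" using that by simp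
      have "?X S \<noteq> \<infinity>" using X_le[OF that] False by (auto simp: top_unique)
      then have "ennreal (?D S) \<le> ennreal (covar (noise h S) (marginal_mean ?M {1..n} S ?f) (marginal_mean ?M {1..n} S ?f)) * ?X S"
        by (rule smoothed_diff_bound[OF Ab z S])
      also have "\<dots> \<le> ennreal (sum d S) * m"
        by (intro mult_mono ennreal_leI d(3) S X_le that) auto
      finally show ?thesis .
    qed
    have c: "0 \<le> ?c" by simp
    have "ennreal (?c * (\<Sum>S\<in>?F. ?D S)) = ennreal ?c * (\<Sum>S\<in>?F. ennreal (?D S))"
      unfolding ennreal_mult'[OF c] by (simp add: sum_ennreal)
    also have "\<dots> \<le> ennreal ?c * (\<Sum>S\<in>?F. ennreal (sum d S) * m)"
      by (intro mult_left_mono sum_mono D_le) auto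
    also have "\<dots> = ennreal (?c * (\<Sum>S\<in>?F. sum d S)) * m"
      by (simp only: sum_distrib_right[symmetric] sum_ennreal[OF sum_nonneg[OF d(1)]] ennreal_mult'[OF c] mult.assoc)
    also have "\<dots> \<le> ennreal 1 * m"
    proof (intro mult_right_mono ennreal_leI)
      have "?c * (\<Sum>S\<in>?F. sum d S) = 4 * sum d {1..n}"
        unfolding sum_over_subsets_of_card[OF s] using s by (simp add: field_simps)
      with d_quarter show "?c * (\<Sum>S\<in>?F. sum d S) \<le> 1" by simp
    qed simp
    finally show ?thesis by simp
  qed simp
  then show ?thesis by (simp add: m_def)
qed

end

theorem proposition6:
  fixes n s :: nat
    and \<pi> \<nu> :: "(nat \<Rightarrow> real) measure"
    and h :: "real \<Rightarrow> real"
    and A :: "(nat \<Rightarrow> real) \<Rightarrow> real"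
  assumes "1 \<le> s" and "s \<le> n"
    and "prob_space \<pi>" and "sets \<pi> = sets (vec_borel {1..n})"
    and "prob_space \<nu>" and "sets \<nu> = sets (vec_borel {1..n})"
    and "h \<in> borel_measurable borel" and "\<And>t. 0 \<le> h t"
    and "(\<integral>\<^sup>+ t. ennreal (h t) \<partial>lborel) = 1"
    and "A \<in> borel_measurable (vec_borel {1..n})"
    and "A \<in> space (vec_borel {1..n}) \<rightarrow> {0..1}"
  shows "ennreal (1 / real (n choose s) *
           (\<Sum>S | S \<subseteq> {1..n} \<and> card S = s.
              \<integral>(Z, \<zeta>). (smoothed h n A Z - smoothed h n A (resample n S Z \<zeta>))\<^sup>2 \<partial>(\<pi> \<Otimes>\<^sub>M \<nu>)))
         \<le> ennreal (real s / (4 * real n)) *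
           (\<integral>\<^sup>+ (Z, \<zeta>). (MAX S\<in>{S. S \<subseteq> {1..n} \<and> card S = s}.
              shift_chi2 h S (\<lambda>i\<in>S. \<zeta> i - Z i)) \<partial>(\<pi> \<Otimes>\<^sub>M \<nu>))"
proof -
  let ?F = "{S. S \<subseteq> {1..n} \<and> card S = s}"
  let ?c = "4 * real n / real s / real (n choose s)"
  let ?P = "\<pi> \<Otimes>\<^sub>M \<nu>"
  let ?D = "\<lambda>S (Z, \<zeta>). (smoothed h n A Z - smoothed h n A (resample n S Z \<zeta>))\<^sup>2"
  let ?X = "\<lambda>(Z, \<zeta>). MAX S\<in>?F. shift_chi2 h S (\<lambda>i\<in>S. \<zeta> i - Z i)"
  note [measurable_cong] = assms(4,6)
  interpret pi: prob_space \<pi> by fact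
  interpret nu: prob_space \<nu> by fact
  interpret P: pair_prob_space \<pi> \<nu> ..
  have A: "bounded_measurable (vec_borel {1..n}) A"
    using assms(10,11) by (intro bounded_measurableI[where B=1]) (auto simp: Pi_iff)
  note sm = bounded_measurable_smoothed[OF assms(7,9) A]
  have D: "bounded_measurable ?P (?D S)" for S
  proof -
    have fst: "bounded_measurable ?P (\<lambda>p. smoothed h n A (fst p))"
      by (rule bounded_measurable_compose[OF _ sm]) measurable
    have snd: "bounded_measurable ?P (\<lambda>p. smoothed h n A (resample n S (fst p) (snd p)))"
      unfolding resample_def by (rule bounded_measurable_compose[OF _ sm]) measurable
    have "bounded_measurable ?P (\<lambda>p. smoothed h n A (fst p) + (- 1) * smoothed h n A (resample n S (fst p) (snd p)))"
      by (intro bounded_measurable_add bounded_measurable_mult bounded_measurable_const fst snd)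
    from bounded_measurable_mult[OF this this] show ?thesis
      by (simp add: case_prod_beta' power2_eq_square)
  qed
  have iD: "integrable ?P (?D S)" for S
    by (rule P.bounded_measurable_integrable[OF D])
  have c: "0 \<le> ?c" by simp
  have nonneg: "0 \<le> ?D S p" for S p by (simp add: case_prod_beta')
  have "1 / real (n choose s) * (\<Sum>S\<in>?F. integral\<^sup>L ?P (?D S))
      = real s / (4 * real n) * (\<integral>p. ?c * (\<Sum>S\<in>?F. ?D S p) \<partial>?P)"
    using assms(1,2) iD by simp
  then have "ennreal (1 / real (n choose s) * (\<Sum>S\<in>?F. integral\<^sup>L ?P (?D S)))
      = ennreal (real s / (4 * real n)) * ennreal (\<integral>p. ?c * (\<Sum>S\<in>?F. ?D S p) \<partial>?P)"
    by (simp only: ennreal_mult' divide_nonneg_nonneg of_nat_0_le_iff mult_nonneg_nonneg zero_le_numeral)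
  also have "ennreal (\<integral>p. ?c * (\<Sum>S\<in>?F. ?D S p) \<partial>?P) = (\<integral>\<^sup>+p. ennreal (?c * (\<Sum>S\<in>?F. ?D S p)) \<partial>?P)"
    by (intro nn_integral_eq_integral[symmetric] AE_I2 mult_nonneg_nonneg[OF c] sum_nonneg[OF nonneg]
        integrable_mult_right Bochner_Integration.integrable_sum iD)
  also have "\<dots> \<le> integral\<^sup>N ?P ?X"
  proof (rule nn_integral_mono)
    fix p assume "p \<in> space ?P"
    then have "fst p \<in> space \<pi>" by (rule measurable_space[OF measurable_fst])
    then have "fst p \<in> space (vec_borel {1..n})"
      unfolding sets_eq_imp_space_eq[OF assms(4)] .
    from smoothed_resample_pointwise[OF assms(7,9,1,2,10,11) this, of "snd p"]
    show "ennreal (?c * (\<Sum>S\<in>?F. ?D S p)) \<le> ?X p"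
      by (simp add: case_prod_beta')
  qed
  finally show ?thesis by (simp add: mult_left_mono)
qed

end
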